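(* Let $\mathcal{M}_1 = (V, \mathcal{I}_1)$ and $\mathcal{M}_2 = (V, \mathcal{I}_2)$ be two matroids on the same ground set $V$ with $|V| = n$, accessible only through rank oracles, and let $r$ be the maximum cardinality of a common independent set. For any $\varepsilon > 0$, there is a deterministic algorithm that finds a common independent set $S \in \mathcal{I}_1 \cap \mathcal{I}_2$ with $|S| \geq (2/3 - \varepsilon) r$, using $O(\frac{n}{\varepsilon})$ rank oracle queries.
   Context: A matroid $\mathcal{M} = (V,\mathcal{I})$ is given by a finite ground set $V$ and a nonempty family $\mathcal{I}\subseteq 2^V$ of independent sets satisfying the downward closure and augmentation properties. For $S\subseteq V$, $\mathrm{rank}_{\mathcal{M}}(S) = \max\{|T| : T\subseteq S, T\in\mathcal{I}\}$. A common independent set of $\mathcal{M}_1,\mathcal{M}_2$ is a set in $\mathcal{I}_1 \cap \mathcal{I}_2$. A rank oracle for $\mathcal{M}_i$ takes as input a subset $S \subseteq V$ and returns $\mathrm{rank}_{\mathcal{M}_i}(S)$; each such call counts as one query. *)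

theory Defs
  imports Complex_Main
begin

locale matroid =
  fixes V :: "'a set" and \<I> :: "'a set set"
  assumes finite_ground: "finite V"
    and indep_subset_ground: "\<I> \<subseteq> Pow V"
    and indep_nonempty: "\<I> \<noteq> {}"
    and downward_closed: "T \<in> \<I> \<Longrightarrow> S \<subseteq> T \<Longrightarrow> S \<in> \<I>"
    and augmentation: "S \<in> \<I> \<Longrightarrow> T \<in> \<I> \<Longrightarrow> card S < card T \<Longrightarrow> \<exists>x\<in>T - S. insert x S \<in> \<I>"

definition matroid_rank :: "'a set set \<Rightarrow> 'a set \<Rightarrow> nat" where
  "matroid_rank \<I> S = Max {card T |T. T \<subseteq> S \<and> T \<in> \<I>}"

definition max_common_indep :: "'a set set \<Rightarrow> 'a set set \<Rightarrow> nat" where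
  "max_common_indep \<I>1 \<I>2 = Max {card S |S. S \<in> \<I>1 \<inter> \<I>2}"

text \<open>
  A deterministic algorithm with oracle access is an adaptive decision tree: it either stops with
  an output or asks one of the two oracles for the rank of a set and continues depending on the
  answer. Only oracle calls are counted; the computation between calls is free. As the datatype is
  well-founded, every run terminates.
\<close>

datatype oracle_id = Oracle1 | Oracle2

datatype 'a rank_algorithm =
    Output "'a set"
  | Query oracle_id "'a set" "nat \<Rightarrow> 'a rank_algorithm"

type_synonym 'a rank_oracles = "oracle_id \<Rightarrow> 'a set \<Rightarrow> nat"

primrec result :: "'a rank_oracles \<Rightarrow> 'a rank_algorithm \<Rightarrow> 'a set" where
  "result orc (Output S) = S"
| "result orc (Query i S k) = result orc (k (orc i S))"

text \<open>The calls made during a run, in order; repeated calls are listed, hence counted, repeatedly.\<close>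

primrec queries :: "'a rank_oracles \<Rightarrow> 'a rank_algorithm \<Rightarrow> (oracle_id \<times> 'a set) list" where
  "queries orc (Output S) = []"
| "queries orc (Query i S k) = (i, S) # queries orc (k (orc i S))"

fun rank_oracles :: "'a set set \<Rightarrow> 'a set set \<Rightarrow> 'a rank_oracles" where
  "rank_oracles \<I>1 \<I>2 Oracle1 S = matroid_rank \<I>1 S"
| "rank_oracles \<I>1 \<I>2 Oracle2 S = matroid_rank \<I>2 S"

end

theory Submission imports Defs begin

text \<open>
  The algorithm keeps a common independent set \<open>S = P \<union> Q\<close> with \<open>P\<close> and \<open>Q\<close> disjoint such that
  \<open>V = cl\<^sub>1 P \<union> cl\<^sub>2 (P \<union> Q)\<close>. As in an auction with prices \<open>0, 1, 2\<close>, the elements of \<open>P\<close> hold a bid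
  of \<open>1\<close> and those of \<open>Q\<close> a bid of \<open>2\<close> towards the second matroid. A pass greedily extends \<open>Q\<close> to \<open>Q'\<close>,
  keeping \<open>P \<union> Q'\<close> independent in the first matroid and \<open>Q'\<close> in the second, then thins out \<open>P\<close>
  greedily until it fits with \<open>Q'\<close>, and refills it greedily to \<open>P'\<close>. Now
  \<open>V = cl\<^sub>1 P' \<union> cl\<^sub>2 (P' \<union> Q')\<close> and \<open>V = cl\<^sub>1 (P \<union> Q') \<union> cl\<^sub>2 Q'\<close>, and adding the two bounds on \<open>r\<close> yields
  \<open>2 r \<le> 3 \<bar>P' \<union> Q'\<bar> + \<bar>Q'\<bar> - \<bar>Q\<bar>\<close>. Since \<open>Q\<close> only grows, the error terms telescope to at most \<open>r\<close>
  over all passes, and since \<open>\<bar>S\<bar>\<close> never decreases, \<open>O(1/\<epsilon>)\<close> passes of \<open>O(n)\<close> queries suffice.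
\<close>

section \<open>Closure and exchange in a single matroid\<close>

text \<open>The span of an independent \<open>I\<close>, phrased through independence alone. Points
  outside the ground set belong to it vacuously, which is harmless since only its part inside
  \<open>V\<close> matters.\<close>

definition matroid_closure :: "'a set set \<Rightarrow> 'a set \<Rightarrow> 'a set" where
  "matroid_closure \<I> I = {v. insert v I \<in> \<I> \<longrightarrow> v \<in> I}"

context matroid
begin

lemma indep_subset: "I \<in> \<I> \<Longrightarrow> I \<subseteq> V"
  using indep_subset_ground by auto

lemma indep_finite: "I \<in> \<I> \<Longrightarrow> finite I"
  using finite_ground finite_subset indep_subset by blast

lemma empty_indep: "{} \<in> \<I>"
  using indep_nonempty downward_closed by blast

lemma finite_indep_sets: "finite \<I>"
  using finite_ground indep_subset_ground finite_subset by blast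

text \<open>Lets a single rank query serve as an independence test: an independent subset of
  \<open>X\<close> with \<open>card X\<close> elements is \<open>X\<close> itself, by
  finiteness.\<close>

lemma matroid_rank_eq_card_iff:
  assumes "X \<subseteq> V"
  shows "matroid_rank \<I> X = card X \<longleftrightarrow> X \<in> \<I>"
proof -
  let ?R = "{card T |T. T \<subseteq> X \<and> T \<in> \<I>}"
  have finX: "finite X"
    using assms finite_ground by (rule finite_subset)
  have "?R = card ` {T. T \<subseteq> X \<and> T \<in> \<I>}" by blast
  moreover have "finite {T. T \<subseteq> X \<and> T \<in> \<I>}" using finite_indep_sets by simp
  ultimately have fin: "finite ?R" by simp
  have ne: "?R \<noteq> {}" using empty_indep by blast
  show ?thesis
  proof
    assume "matroid_rank \<I> X = card X"
    then have "card X \<in> ?R"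
      using Max_in[OF fin ne] unfolding matroid_rank_def by simp
    then obtain T where "T \<subseteq> X" "T \<in> \<I>" "card T = card X" by auto
    then show "X \<in> \<I>" using card_subset_eq finX by metis
  next
    assume "X \<in> \<I>"
    then show "matroid_rank \<I> X = card X"
      unfolding matroid_rank_def
      by (intro Max_eqI[OF fin]) (auto intro: card_mono[OF finX])
  qed
qed

text \<open>If \<open>J\<close> were larger, augmentation would supply an element of
  \<open>J - I\<close> extending \<open>I\<close>, which the closure excludes.\<close>

lemma card_le_closure:
  assumes "I \<in> \<I>" "J \<in> \<I>" "J \<subseteq> matroid_closure \<I> I"
  shows "card J \<le> card I"
proof (rule ccontr)
  assume "\<not> ?thesis"
  then obtain x where "x \<in> J - I" "insert x I \<in> \<I>"
    using augmentation[OF assms(1,2)] by (meson not_le)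
  then show False using assms(3) unfolding matroid_closure_def by blast
qed

lemma exists_extension:
  assumes "I \<in> \<I>" "J \<in> \<I>" "card I \<le> card J"
  shows "\<exists>K\<in>\<I>. I \<subseteq> K \<and> K \<subseteq> I \<union> J \<and> card K = card J"
  using assms
proof (induction "card J - card I" arbitrary: I)
  case 0
  then show ?case by auto
next
  case (Suc d)
  then have "card I < card J" by simp
  then obtain x where x: "x \<in> J - I" "insert x I \<in> \<I>"
    using augmentation[of I J] Suc.prems by blast
  then have "card (insert x I) = Suc (card I)"
    using indep_finite[OF Suc.prems(1)] by simp
  then have "d = card J - card (insert x I)" "card (insert x I) \<le> card J"
    using Suc.hyps(2) by simp_all
  from Suc.hyps(1)[OF this(1) x(2) Suc.prems(2) this(2)]
  obtain K where "K \<in> \<I>" "insert x I \<subseteq> K" "K \<subseteq> insert x I \<union> J" "card K = card J"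
    by blast
  then show ?case using x by blast
qed

text \<open>If \<open>v\<close> lay in the first closure only, \<open>I\<close> would extend inside
  \<open>I \<union> insert v J\<close> to an independent \<open>K\<close> of size
  \<open>Suc (card J)\<close>. As \<open>insert v I\<close> is dependent, \<open>K\<close> avoids
  \<open>v\<close> and hence lies in the closure of \<open>J\<close>, where it is too large.\<close>

lemma closure_subset_closure:
  assumes I: "I \<in> \<I>" and J: "J \<in> \<I>" and sub: "I \<subseteq> matroid_closure \<I> J"
  shows "matroid_closure \<I> I \<subseteq> matroid_closure \<I> J"
proof (rule ccontr)
  assume "\<not> ?thesis"
  then obtain v where v: "v \<in> matroid_closure \<I> I" "insert v J \<in> \<I>" "v \<notin> J"
    unfolding matroid_closure_def by blast
  have "v \<notin> I" using v sub unfolding matroid_closure_def by blast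
  then have dep: "insert v I \<notin> \<I>" using v(1) unfolding matroid_closure_def by blast
  have cv: "card (insert v J) = Suc (card J)" using indep_finite[OF J] v(3) by simp
  then obtain K where K: "K \<in> \<I>" "I \<subseteq> K" "K \<subseteq> I \<union> insert v J" "card K = Suc (card J)"
    using exists_extension[OF I v(2)] card_le_closure[OF J I sub] by auto
  have "v \<notin> K" using dep downward_closed[OF K(1), of "insert v I"] K(2) by auto
  then have "K \<subseteq> matroid_closure \<I> J"
    using K(3) sub unfolding matroid_closure_def by blast
  then show False using card_le_closure[OF J K(1)] K(4) by simp
qed

text \<open>Extend \<open>J\<close> by elements of \<open>P \<union> Q\<close> to an independent
  \<open>K\<close> of size \<open>card (P \<union> Q)\<close>. The part of \<open>K\<close> outside
  \<open>Q\<close> is spanned by \<open>P\<close> and has at most \<open>card P\<close> elements, so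
  counting forces \<open>Q \<subseteq> K\<close>.\<close>

lemma indep_Un_exchange:
  assumes PQ: "P \<union> Q \<in> \<I>" "P \<inter> Q = {}" and J: "J \<in> \<I>" "J \<subseteq> matroid_closure \<I> P"
  shows "J \<union> Q \<in> \<I>"
proof -
  have P: "P \<in> \<I>" by (rule downward_closed[OF PQ(1)]) simp
  have fin: "finite P" "finite Q" using indep_finite[OF PQ(1)] by auto
  have "card J \<le> card (P \<union> Q)"
    using card_le_closure[OF P J] card_mono[of "P \<union> Q" P] fin by simp
  then obtain K where K: "K \<in> \<I>" "J \<subseteq> K" "K \<subseteq> J \<union> (P \<union> Q)" "card K = card (P \<union> Q)"
    using exists_extension[OF J(1) PQ(1)] by auto
  have "K - Q \<subseteq> matroid_closure \<I> P"
    using K(3) J(2) unfolding matroid_closure_def by blast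
  then have "card (K - Q) \<le> card P"
    by (rule card_le_closure[OF P downward_closed[OF K(1)], rotated]) simp
  moreover have "card K = card (K - Q) + card (K \<inter> Q)"
    using indep_finite[OF K(1)] by (metis add.commute card_Int_Diff)
  moreover have "card (P \<union> Q) = card P + card Q"
    using card_Un_disjoint[OF fin PQ(2)] .
  ultimately have "card Q \<le> card (K \<inter> Q)" using K(4) by simp
  then have "Q \<subseteq> K" using card_seteq[OF fin(2), of "K \<inter> Q"] by auto
  then show ?thesis using downward_closed[OF K(1), of "J \<union> Q"] K(2) by simp
qed

end

section \<open>The algorithm as a decision tree of greedy scans\<close>

text \<open>Fixing one enumeration by choice keeps the algorithm deterministic and costs no
  query.\<close>

definition list_of :: "'a set \<Rightarrow> 'a list" where
  "list_of X = (SOME xs. set xs = X \<and> distinct xs)"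

lemma
  assumes "finite X"
  shows set_list_of: "set (list_of X) = X" and length_list_of: "length (list_of X) = card X"
proof -
  have *: "set (list_of X) = X \<and> distinct (list_of X)"
    unfolding list_of_def using someI_ex[OF finite_distinct_list[OF assms]] .
  then show "set (list_of X) = X" by simp
  from * show "length (list_of X) = card X" using distinct_card by metis
qed

text \<open>Decision trees have no sequencing operation, so the accumulated set is handed to a
  continuation \<open>k\<close>. The sets \<open>A\<close> and \<open>B\<close> stay fixed beside it
  in the first and the second matroid. Both oracles are always asked, which makes the query count
  exact.\<close>

primrec greedy :: "'a set \<Rightarrow> 'a set \<Rightarrow> 'a list \<Rightarrow> ('a set \<Rightarrow> 'a rank_algorithm) \<Rightarrow> 'a set \<Rightarrow> 'a rank_algorithm" where
  "greedy A B [] k X = k X"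
| "greedy A B (v # vs) k X =
     Query Oracle1 (A \<union> insert v X) (\<lambda>p. Query Oracle2 (B \<union> insert v X) (\<lambda>q.
       greedy A B vs k
         (if p = card (A \<union> insert v X) \<and> q = card (B \<union> insert v X) then insert v X else X)))"

text \<open>The first scan fixes \<open>P\<close> in the first matroid only, so \<open>Q'\<close>
  may conflict with \<open>P\<close> in the second. The thinned set \<open>R\<close> is built up
  from the empty set rather than by deletions, and the third scan starts from it.\<close>

primrec passes :: "'a set \<Rightarrow> nat \<Rightarrow> 'a set \<Rightarrow> 'a set \<Rightarrow> 'a rank_algorithm" where
  "passes V 0 P Q = Output (P \<union> Q)"
| "passes V (Suc t) P Q =
     greedy P {} (list_of (V - P)) (\<lambda>Q'.
       greedy Q' Q' (list_of P) (\<lambda>R.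
         greedy Q' Q' (list_of (V - Q')) (\<lambda>P'. passes V t P' Q') R) {}) Q"

definition approx_matroid_intersection :: "nat \<Rightarrow> 'a set \<Rightarrow> 'a rank_algorithm" where
  "approx_matroid_intersection t V = greedy {} {} (list_of V) (\<lambda>P. passes V t P {}) {}"

section \<open>Guarantees of a greedy scan\<close>

locale matroid_pair = M1: matroid V \<I>1 + M2: matroid V \<I>2
  for V :: "'a set" and \<I>1 \<I>2
begin

abbreviation "orc \<equiv> rank_oracles \<I>1 \<I>2"
abbreviation "cl1 \<equiv> matroid_closure \<I>1"
abbreviation "cl2 \<equiv> matroid_closure \<I>2"

definition legal :: "'a rank_algorithm \<Rightarrow> bool" where
  "legal a \<longleftrightarrow> (\<forall>(i, Z) \<in> set (queries orc a). Z \<subseteq> V)"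

text \<open>The accumulated set only grows, so by downward closure an element that fits at the end
  also fitted when it was scanned and was accepted then. Hence one scan suffices for
  maximality.\<close>

lemma greedy_spec:
  assumes "set vs \<subseteq> V" "A \<union> X \<in> \<I>1" "B \<union> X \<in> \<I>2"
  shows "\<exists>Y. result orc (greedy A B vs k X) = result orc (k Y)
    \<and> length (queries orc (greedy A B vs k X)) = 2 * length vs + length (queries orc (k Y))
    \<and> (legal (k Y) \<longrightarrow> legal (greedy A B vs k X))
    \<and> X \<subseteq> Y \<and> Y \<subseteq> X \<union> set vs \<and> A \<union> Y \<in> \<I>1 \<and> B \<union> Y \<in> \<I>2
    \<and> (\<forall>v\<in>set vs. A \<union> insert v Y \<in> \<I>1 \<longrightarrow> B \<union> insert v Y \<in> \<I>2 \<longrightarrow> v \<in> Y)"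
  using assms
proof (induction vs arbitrary: X)
  case Nil
  then show ?case by auto
next
  case (Cons v vs)
  have sub: "A \<union> insert v X \<subseteq> V" "B \<union> insert v X \<subseteq> V"
    using Cons.prems M1.indep_subset M2.indep_subset by auto
  define X' where "X' = (if A \<union> insert v X \<in> \<I>1 \<and> B \<union> insert v X \<in> \<I>2 then insert v X else X)"
  have step: "result orc (greedy A B (v # vs) k X) = result orc (greedy A B vs k X')"
    "queries orc (greedy A B (v # vs) k X) = (Oracle1, A \<union> insert v X)
       # (Oracle2, B \<union> insert v X) # queries orc (greedy A B vs k X')"
    unfolding X'_def
    by (simp_all only: greedy.simps result.simps queries.simps rank_oracles.simps
        M1.matroid_rank_eq_card_iff[OF sub(1)] M2.matroid_rank_eq_card_iff[OF sub(2)])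
  have "A \<union> X' \<in> \<I>1" "B \<union> X' \<in> \<I>2" "set vs \<subseteq> V"
    using Cons.prems unfolding X'_def by auto
  from Cons.IH[OF this(3,1,2)] obtain Y where
    res: "result orc (greedy A B vs k X') = result orc (k Y)" and
    len: "length (queries orc (greedy A B vs k X')) = 2 * length vs + length (queries orc (k Y))" and
    qry: "legal (k Y) \<longrightarrow> legal (greedy A B vs k X')" and
    Y: "X' \<subseteq> Y" "Y \<subseteq> X' \<union> set vs" "A \<union> Y \<in> \<I>1" "B \<union> Y \<in> \<I>2" and
    maxi: "\<forall>u\<in>set vs. A \<union> insert u Y \<in> \<I>1 \<longrightarrow> B \<union> insert u Y \<in> \<I>2 \<longrightarrow> u \<in> Y"
    by blast
  have XX': "X \<subseteq> X'" "X' \<subseteq> insert v X" unfolding X'_def by auto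
  have "v \<in> Y" if "A \<union> insert v Y \<in> \<I>1" "B \<union> insert v Y \<in> \<I>2"
  proof -
    have "X \<subseteq> Y" using XX' Y(1) by blast
    then have "A \<union> insert v X \<subseteq> A \<union> insert v Y" "B \<union> insert v X \<subseteq> B \<union> insert v Y"
      by blast+
    then have "A \<union> insert v X \<in> \<I>1" "B \<union> insert v X \<in> \<I>2"
      using M1.downward_closed[OF that(1)] M2.downward_closed[OF that(2)] by simp_all
    then show "v \<in> Y" using Y(1) unfolding X'_def by simp
  qed
  then have maxi': "\<forall>u\<in>set (v # vs). A \<union> insert u Y \<in> \<I>1 \<longrightarrow> B \<union> insert u Y \<in> \<I>2 \<longrightarrow> u \<in> Y"
    using maxi by simp
  have "X \<subseteq> Y" "Y \<subseteq> X \<union> set (v # vs)"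
    using XX' Y(1,2) by auto
  moreover have "legal (k Y) \<longrightarrow> legal (greedy A B (v # vs) k X)"
    using qry sub unfolding legal_def step by simp
  moreover have "length (queries orc (greedy A B (v # vs) k X))
      = 2 * length (v # vs) + length (queries orc (k Y))"
    unfolding step using len by simp
  moreover have "result orc (greedy A B (v # vs) k X) = result orc (k Y)"
    unfolding step using res .
  ultimately show ?case using Y(3,4) maxi' by blast
qed

lemma greedy_list_of:
  assumes W: "W \<subseteq> V" and X: "A \<union> X \<in> \<I>1" "B \<union> X \<in> \<I>2"
  obtains Y where "result orc (greedy A B (list_of W) k X) = result orc (k Y)"
    "length (queries orc (greedy A B (list_of W) k X)) = 2 * card W + length (queries orc (k Y))"
    "legal (k Y) \<longrightarrow> legal (greedy A B (list_of W) k X)"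
    "X \<subseteq> Y" "Y \<subseteq> X \<union> W" "A \<union> Y \<in> \<I>1" "B \<union> Y \<in> \<I>2"
    "\<forall>v\<in>W. A \<union> insert v Y \<in> \<I>1 \<longrightarrow> B \<union> insert v Y \<in> \<I>2 \<longrightarrow> v \<in> Y"
proof -
  have "finite W" using W M1.finite_ground by (rule finite_subset)
  note ls = set_list_of[OF this] length_list_of[OF this]
  have "set (list_of W) \<subseteq> V" using W ls(1) by simp
  from greedy_spec[OF this X, of k, unfolded ls] show thesis
    using that by blast
qed

section \<open>Upper bounds from covers, and the analysis of one pass\<close>

text \<open>Weak duality for matroid intersection: \<open>T\<close> splits into a part spanned by
  \<open>I\<close> in the first matroid and a part spanned by \<open>J\<close> in the
  second.\<close>

lemma card_cover:
  assumes "T \<in> \<I>1 \<inter> \<I>2" "I \<in> \<I>1" "J \<in> \<I>2" "V \<subseteq> cl1 I \<union> cl2 J"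
  shows "card T \<le> card I + card J"
proof -
  have T: "T \<in> \<I>1" "T \<in> \<I>2" "T \<subseteq> V" using assms(1) M1.indep_subset by auto
  have "card (T \<inter> cl1 I) \<le> card I"
    by (rule M1.card_le_closure[OF assms(2) M1.downward_closed[OF T(1)]]) simp_all
  moreover have "card (T \<inter> cl2 J) \<le> card J"
    by (rule M2.card_le_closure[OF assms(3) M2.downward_closed[OF T(2)]]) simp_all
  moreover have "T \<inter> cl1 I \<union> T \<inter> cl2 J = T" using T(3) assms(4) by blast
  then have "card T \<le> card (T \<inter> cl1 I) + card (T \<inter> cl2 J)"
    using card_Un_le[of "T \<inter> cl1 I" "T \<inter> cl2 J"] by simp
  ultimately show ?thesis by simp
qed

definition pass_inv :: "'a set \<Rightarrow> 'a set \<Rightarrow> bool" where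
  "pass_inv P Q \<longleftrightarrow> P \<inter> Q = {} \<and> P \<union> Q \<in> \<I>1 \<inter> \<I>2 \<and> V \<subseteq> cl1 P \<union> cl2 (P \<union> Q)"

text \<open>The assumptions collect what the three scans guarantee, so the argument is about sets
  alone and no longer about decision trees.\<close>

lemma pass_step:
  assumes inv: "pass_inv P Q"
    and Q': "Q \<subseteq> Q'" "P \<inter> Q' = {}" "P \<union> Q' \<in> \<I>1" "Q' \<in> \<I>2"
    and Q'_max: "\<forall>v\<in>V - P. P \<union> insert v Q' \<in> \<I>1 \<longrightarrow> insert v Q' \<in> \<I>2 \<longrightarrow> v \<in> Q'"
    and R: "R \<subseteq> P" "R \<subseteq> P'"
    and R_max: "\<forall>v\<in>P. Q' \<union> insert v R \<in> \<I>1 \<longrightarrow> Q' \<union> insert v R \<in> \<I>2 \<longrightarrow> v \<in> R"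
    and P': "P' \<inter> Q' = {}" "Q' \<union> P' \<in> \<I>1" "Q' \<union> P' \<in> \<I>2"
    and P'_max: "\<forall>v\<in>V - Q'. Q' \<union> insert v P' \<in> \<I>1 \<longrightarrow> Q' \<union> insert v P' \<in> \<I>2 \<longrightarrow> v \<in> P'"
  shows "pass_inv P' Q'" "card (P \<union> Q) \<le> card (P' \<union> Q')"
    and "T \<in> \<I>1 \<inter> \<I>2 \<Longrightarrow> 2 * card T + card Q \<le> 3 * card (P' \<union> Q') + card Q'"
proof -
  have PQ: "P \<inter> Q = {}" "P \<union> Q \<in> \<I>1" "P \<union> Q \<in> \<I>2" "V \<subseteq> cl1 P \<union> cl2 (P \<union> Q)"
    using inv unfolding pass_inv_def by auto
  have "R \<union> Q' \<in> \<I>2"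
    by (rule M2.downward_closed[OF P'(3)]) (use R(2) in blast)
  then have RQ: "R \<union> Q' \<in> \<I>2" "P' \<union> Q' \<in> \<I>2" "P' \<union> Q' \<in> \<I>1"
    using P' by (simp_all add: Un_commute)
  \<comment> \<open>While thinning \<open>P\<close>, the first matroid never objects because
    \<open>P \<union> Q'\<close> is independent there; every dropped element is therefore spanned in
    the second.\<close>
  have cov: "P \<union> Q \<subseteq> cl2 (R \<union> Q')"
  proof
    fix v assume v: "v \<in> P \<union> Q"
    show "v \<in> cl2 (R \<union> Q')"
    proof (cases "v \<in> P")
      case True
      have "Q' \<union> insert v R \<in> \<I>1"
        by (rule M1.downward_closed[OF Q'(3)]) (use True R(1) in blast)
      moreover have "Q' \<union> insert v R = insert v (R \<union> Q')" by blast
      ultimately show ?thesis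
        using bspec[OF R_max True] unfolding matroid_closure_def by simp
    qed (use v Q'(1) in \<open>auto simp: matroid_closure_def\<close>)
  qed
  have clR: "cl2 (P \<union> Q) \<subseteq> cl2 (R \<union> Q')"
    using M2.closure_subset_closure[OF PQ(3) RQ(1) cov] .
  have "cl2 (R \<union> Q') \<subseteq> cl2 (P' \<union> Q')"
    by (rule M2.closure_subset_closure[OF RQ(1,2)]) (use R(2) in \<open>auto simp: matroid_closure_def\<close>)
  then have cl': "cl2 (P \<union> Q) \<subseteq> cl2 (P' \<union> Q')" and cov': "P \<union> Q \<subseteq> cl2 (P' \<union> Q')"
    using clR cov by auto
  \<comment> \<open>A refilled element lies outside \<open>cl2 (R \<union> Q')\<close>, hence
    outside \<open>cl2 (P \<union> Q)\<close>, so the old invariant places it in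
    \<open>cl1 P\<close>.\<close>
  have P'cl: "P' \<subseteq> cl1 P"
  proof
    fix v assume v: "v \<in> P'"
    show "v \<in> cl1 P"
    proof (cases "v \<in> R")
      case True
      then show ?thesis using R(1) unfolding matroid_closure_def by blast
    next
      case False
      have "insert v (R \<union> Q') \<in> \<I>2"
        by (rule M2.downward_closed[OF RQ(2)]) (use R(2) v in blast)
      then have "v \<notin> cl2 (R \<union> Q')"
        using False v P'(1) unfolding matroid_closure_def by blast
      then show ?thesis
        using clR PQ(4) v M1.indep_subset[OF P'(2)] by blast
    qed
  qed
  \<comment> \<open>An uncovered \<open>v\<close> lies in \<open>cl1 P\<close> by the old invariant.
    Exchanging \<open>P\<close> for \<open>insert v P'\<close> beside \<open>Q'\<close> makes
    \<open>v\<close> acceptable to the third scan, against its maximality.\<close>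
  have cover1: "V \<subseteq> cl1 P' \<union> cl2 (P' \<union> Q')"
  proof (rule ccontr)
    assume "\<not> ?thesis"
    then obtain v where v: "v \<in> V" "insert v P' \<in> \<I>1" "v \<notin> P'"
      "insert v (P' \<union> Q') \<in> \<I>2" "v \<notin> P' \<union> Q'" "v \<notin> cl2 (P' \<union> Q')"
      unfolding matroid_closure_def by blast
    have "v \<in> cl1 P" using v PQ(4) cl' by blast
    then have "insert v P' \<union> Q' \<in> \<I>1"
      using M1.indep_Un_exchange[OF Q'(3,2) v(2)] P'cl by blast
    moreover have "insert v P' \<union> Q' = Q' \<union> insert v P'" "insert v (P' \<union> Q') = Q' \<union> insert v P'"
      by blast+
    ultimately show False using bspec[OF P'_max, of v] v(1,3-5) by simp
  qed
  show "pass_inv P' Q'"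
    using cover1 P'(1) RQ unfolding pass_inv_def by simp
  show card_mono: "card (P \<union> Q) \<le> card (P' \<union> Q')"
    using M2.card_le_closure[OF RQ(2) PQ(3) cov'] .
  have cover2: "V \<subseteq> cl1 (P \<union> Q') \<union> cl2 Q'"
  proof
    fix v assume "v \<in> V"
    moreover have "P \<union> insert v Q' = insert v (P \<union> Q')" by simp
    ultimately show "v \<in> cl1 (P \<union> Q') \<union> cl2 Q'"
      using bspec[OF Q'_max, of v] unfolding matroid_closure_def by auto
  qed
  have indep: "P' \<in> \<I>1" by (rule M1.downward_closed[OF P'(2)]) simp
  have fin: "finite P" "finite Q" "finite P'" "finite Q'"
    using M1.indep_finite[OF PQ(2)] M1.indep_finite[OF P'(2)] by auto
  have "card (P \<union> Q) = card P + card Q" "card (P \<union> Q') = card P + card Q'"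
    "card (P' \<union> Q') = card P' + card Q'"
    using fin PQ(1) Q'(2) P'(1) by (auto intro: card_Un_disjoint)
  \<comment> \<open>The covers bound \<open>card T\<close> by \<open>2 * card P' + card Q'\<close>
    and by \<open>card P + 2 * card Q'\<close>. In their sum, \<open>card P + card Q\<close> is
    replaced by the at least as large \<open>card P' + card Q'\<close>.\<close>
  then show "2 * card T + card Q \<le> 3 * card (P' \<union> Q') + card Q'" if "T \<in> \<I>1 \<inter> \<I>2"
    using card_cover[OF that indep RQ(2) cover1] card_cover[OF that Q'(3,4) cover2] card_mono
    by linarith
qed

section \<open>Telescoping over all passes\<close>

text \<open>The term \<open>card Q\<close> on the left absorbs the growth of \<open>Q\<close> in
  later passes, and monotone sizes allow the final set to replace every intermediate one.\<close>

lemma passes_spec: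
  assumes "pass_inv P Q" "T \<in> \<I>1 \<inter> \<I>2" "\<And>S. S \<in> \<I>1 \<inter> \<I>2 \<Longrightarrow> card S \<le> card T"
  shows "result orc (passes V t P Q) \<in> \<I>1 \<inter> \<I>2
    \<and> card (P \<union> Q) \<le> card (result orc (passes V t P Q))
    \<and> 2 * t * card T + card Q \<le> 3 * t * card (result orc (passes V t P Q)) + card T
    \<and> legal (passes V t P Q)
    \<and> length (queries orc (passes V t P Q)) \<le> 4 * t * card V"
  using assms(1)
proof (induction t arbitrary: P Q)
  case 0
  \<comment> \<open>With no pass left the inequality is \<open>card Q \<le> card T\<close>; this is
    where the single extra \<open>card T\<close> is spent.\<close>
  then have "Q \<in> \<I>1 \<inter> \<I>2"
    using M1.downward_closed[of "P \<union> Q" Q] M2.downward_closed[of "P \<union> Q" Q]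
    unfolding pass_inv_def by simp
  then show ?case using 0 assms(3)[of Q] unfolding pass_inv_def legal_def by simp
next
  case (Suc t)
  have PQ: "P \<inter> Q = {}" "P \<union> Q \<in> \<I>1" "P \<union> Q \<in> \<I>2"
    using Suc.prems unfolding pass_inv_def by auto
  have Q: "{} \<union> Q \<in> \<I>2" using M2.downward_closed[OF PQ(3), of Q] by simp
  have PV: "P \<subseteq> V" using M1.indep_subset[OF PQ(2)] by simp
  note fin = M1.finite_ground
  have finP: "finite P" using PV fin finite_subset by blast
  define k3 where "k3 Q' P' = passes V t P' Q'" for Q' P'
  define k2 where "k2 Q' R = greedy Q' Q' (list_of (V - Q')) (k3 Q') R" for Q' R
  define k1 where "k1 Q' = greedy Q' Q' (list_of P) (k2 Q') {}" for Q'
  have unfold: "passes V (Suc t) P Q = greedy P {} (list_of (V - P)) k1 Q"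
    unfolding k1_def k2_def k3_def by simp
  obtain Q' where Q'1: "result orc (passes V (Suc t) P Q) = result orc (k1 Q')"
    "length (queries orc (passes V (Suc t) P Q)) = 2 * card (V - P) + length (queries orc (k1 Q'))"
    "legal (k1 Q') \<longrightarrow> legal (passes V (Suc t) P Q)"
    and Q'2: "Q \<subseteq> Q'" "Q' \<subseteq> Q \<union> (V - P)" "P \<union> Q' \<in> \<I>1" "{} \<union> Q' \<in> \<I>2"
    "\<forall>v\<in>V - P. P \<union> insert v Q' \<in> \<I>1 \<longrightarrow> {} \<union> insert v Q' \<in> \<I>2 \<longrightarrow> v \<in> Q'"
    using greedy_list_of[OF Diff_subset PQ(2) Q, of P k1, folded unfold] .
  note Q'2 = Q'2[unfolded Un_empty_left]
  have disj: "P \<inter> Q' = {}" using Q'2(2) PQ(1) by blast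
  have Q'_indep: "Q' \<union> {} \<in> \<I>1" "Q' \<union> {} \<in> \<I>2"
    using Q'2(4) M1.downward_closed[OF Q'2(3), of Q'] by simp_all
  obtain R where R1: "result orc (k1 Q') = result orc (k2 Q' R)"
    "length (queries orc (k1 Q')) = 2 * card P + length (queries orc (k2 Q' R))"
    "legal (k2 Q' R) \<longrightarrow> legal (k1 Q')"
    and R2: "{} \<subseteq> R" "R \<subseteq> {} \<union> P" "Q' \<union> R \<in> \<I>1" "Q' \<union> R \<in> \<I>2"
    "\<forall>v\<in>P. Q' \<union> insert v R \<in> \<I>1 \<longrightarrow> Q' \<union> insert v R \<in> \<I>2 \<longrightarrow> v \<in> R"
    using greedy_list_of[OF PV Q'_indep, of "k2 Q'", folded k1_def] .
  have RP: "R \<subseteq> P" using R2(2) by simp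
  obtain P' where P'1: "result orc (k2 Q' R) = result orc (k3 Q' P')"
    "length (queries orc (k2 Q' R)) = 2 * card (V - Q') + length (queries orc (k3 Q' P'))"
    "legal (k3 Q' P') \<longrightarrow> legal (k2 Q' R)"
    and P'2: "R \<subseteq> P'" "P' \<subseteq> R \<union> (V - Q')" "Q' \<union> P' \<in> \<I>1" "Q' \<union> P' \<in> \<I>2"
    "\<forall>v\<in>V - Q'. Q' \<union> insert v P' \<in> \<I>1 \<longrightarrow> Q' \<union> insert v P' \<in> \<I>2 \<longrightarrow> v \<in> P'"
    using greedy_list_of[OF Diff_subset R2(3,4), of Q' "k3 Q'", folded k2_def] .
  note P'1 = P'1[unfolded k3_def]
  have disj': "P' \<inter> Q' = {}" using P'2(2) RP disj by blast
  note step = pass_step[OF Suc.prems Q'2(1) disj Q'2(3-5) RP P'2(1) R2(5) disj' P'2(3-5)]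
  let ?S = "result orc (passes V t P' Q')"
  have IH: "?S \<in> \<I>1 \<inter> \<I>2" "card (P' \<union> Q') \<le> card ?S"
    "2 * t * card T + card Q' \<le> 3 * t * card ?S + card T"
    "legal (passes V t P' Q')"
    "length (queries orc (passes V t P' Q')) \<le> 4 * t * card V"
    using Suc.IH[OF step(1)] by blast+
  have res: "result orc (passes V (Suc t) P Q) = ?S" using Q'1(1) R1(1) P'1(1) by simp
  have "2 * Suc t * card T + card Q \<le> 3 * Suc t * card ?S + card T"
    using IH(2,3) step(3)[OF assms(2)] by (simp add: algebra_simps)
  \<comment> \<open>The first two scans together visit each element of \<open>V\<close> once and the
    third at most once, at two queries per visit.\<close>
  moreover have "card (V - P) + card P = card V"
    using PV finP fin by (simp add: card_Diff_subset card_mono)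
  then have "length (queries orc (passes V (Suc t) P Q)) \<le> 4 * Suc t * card V"
    using Q'1(2) R1(2) P'1(2) IH(5) card_mono[OF fin, of "V - Q'"] by (simp add: algebra_simps)
  moreover have "card (P \<union> Q) \<le> card ?S" using IH(2) step(2) by simp
  moreover have "legal (passes V (Suc t) P Q)"
    using Q'1(3) R1(3) P'1(3) IH(4) by simp
  ultimately show ?case unfolding res using IH(1) by blast
qed

lemma max_common_indep_attained:
  obtains T where "T \<in> \<I>1 \<inter> \<I>2" "card T = max_common_indep \<I>1 \<I>2"
    "\<And>S. S \<in> \<I>1 \<inter> \<I>2 \<Longrightarrow> card S \<le> card T"
proof -
  let ?C = "{card S |S. S \<in> \<I>1 \<inter> \<I>2}"
  have "?C = card ` (\<I>1 \<inter> \<I>2)" by blast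
  then have fin: "finite ?C" using M1.finite_indep_sets by simp
  have "?C \<noteq> {}" using M1.empty_indep M2.empty_indep by blast
  then have "Max ?C \<in> ?C" using Max_in fin by blast
  then obtain T where "T \<in> \<I>1 \<inter> \<I>2" "card T = Max ?C" by auto
  then show ?thesis using that Max_ge[OF fin] unfolding max_common_indep_def by auto
qed

lemma approx_matroid_intersection_spec:
  defines "S t \<equiv> result orc (approx_matroid_intersection t V)"
  shows "S t \<in> \<I>1 \<inter> \<I>2"
    and "2 * t * max_common_indep \<I>1 \<I>2 \<le> 3 * t * card (S t) + max_common_indep \<I>1 \<I>2"
    and "legal (approx_matroid_intersection t V)"
    and "length (queries orc (approx_matroid_intersection t V)) \<le> (4 * t + 2) * card V"
proof -
  obtain T where T: "T \<in> \<I>1 \<inter> \<I>2" "card T = max_common_indep \<I>1 \<I>2"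
    "\<And>S. S \<in> \<I>1 \<inter> \<I>2 \<Longrightarrow> card S \<le> card T"
    using max_common_indep_attained by blast
  have empty: "{} \<union> {} \<in> \<I>1" "{} \<union> {} \<in> \<I>2"
    using M1.empty_indep M2.empty_indep by auto
  obtain P where P1: "S t = result orc (passes V t P {})"
    "length (queries orc (approx_matroid_intersection t V))
       = 2 * card V + length (queries orc (passes V t P {}))"
    "legal (passes V t P {}) \<longrightarrow> legal (approx_matroid_intersection t V)"
    and P2: "{} \<subseteq> P" "P \<subseteq> {} \<union> V" "{} \<union> P \<in> \<I>1" "{} \<union> P \<in> \<I>2"
    "\<forall>v\<in>V. {} \<union> insert v P \<in> \<I>1 \<longrightarrow> {} \<union> insert v P \<in> \<I>2 \<longrightarrow> v \<in> P"
    using greedy_list_of[OF subset_refl empty, of "\<lambda>P. passes V t P {}",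
          folded approx_matroid_intersection_def S_def] .
  \<comment> \<open>Maximality of the initial common independent set \<open>P\<close> is exactly the
    covering condition for an empty \<open>Q\<close>.\<close>
  have "pass_inv P {}"
    using P2 unfolding pass_inv_def matroid_closure_def by auto
  note spec = passes_spec[OF this T(1,3), of t]
  show "S t \<in> \<I>1 \<inter> \<I>2"
    and "2 * t * max_common_indep \<I>1 \<I>2 \<le> 3 * t * card (S t) + max_common_indep \<I>1 \<I>2"
    and "legal (approx_matroid_intersection t V)"
    and "length (queries orc (approx_matroid_intersection t V)) \<le> (4 * t + 2) * card V"
    using spec P1 T(2) by (auto simp: algebra_simps)
qed

end

section \<open>The number of passes for a given \<epsilon>\<close>

theorem theorem2:
  "\<exists>C::real. \<forall>\<epsilon>::real. \<epsilon> > 0 \<longrightarrow>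
     (\<exists>alg :: 'a set \<Rightarrow> 'a rank_algorithm.
        \<forall>(V :: 'a set) \<I>1 \<I>2. matroid V \<I>1 \<longrightarrow> matroid V \<I>2 \<longrightarrow>
          (let orc = rank_oracles \<I>1 \<I>2;
               S = result orc (alg V);
               qs = queries orc (alg V)
           in S \<in> \<I>1 \<inter> \<I>2
            \<and> real (card S) \<ge> (2 / 3 - \<epsilon>) * real (max_common_indep \<I>1 \<I>2)
            \<and> (\<forall>(i, Q) \<in> set qs. Q \<subseteq> V)
            \<and> real (length qs) \<le> C * (real (card V) / \<epsilon>)))"
proof (intro exI[of _ "6 :: real"] allI impI)
  fix \<epsilon> :: real
  assume eps: "\<epsilon> > 0"
  \<comment> \<open>After \<open>t\<close> passes the loss is at most \<open>r / (3 * t)\<close>,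
    and this \<open>t\<close> is the least making it at most \<open>\<epsilon> * r\<close> for every
    \<open>r\<close>.\<close>
  define t where "t = nat \<lceil>1 / (3 * \<epsilon>)\<rceil>"
  \<comment> \<open>For large \<epsilon> the query bound drops below the cost of even one scan, but
    from \<open>2 / 3\<close> on the size target is nonpositive and the empty set will do.\<close>
  define alg :: "'a set \<Rightarrow> 'a rank_algorithm" where
    "alg = (if \<epsilon> \<ge> 2 / 3 then (\<lambda>V. Output {}) else approx_matroid_intersection t)"
  have "0 \<le> 1 / (3 * \<epsilon>)" using eps by simp
  then have t: "1 / (3 * \<epsilon>) \<le> real t" "real t \<le> 1 / (3 * \<epsilon>) + 1"
    unfolding t_def by linarith+
  have t_pos: "real t > 0" using t(1) eps by (meson divide_pos_pos less_le_trans mult_pos_pos zero_less_numeral zero_less_one)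
  show "\<exists>alg :: 'a set \<Rightarrow> 'a rank_algorithm.
        \<forall>(V :: 'a set) \<I>1 \<I>2. matroid V \<I>1 \<longrightarrow> matroid V \<I>2 \<longrightarrow>
          (let orc = rank_oracles \<I>1 \<I>2;
               S = result orc (alg V);
               qs = queries orc (alg V)
           in S \<in> \<I>1 \<inter> \<I>2
            \<and> real (card S) \<ge> (2 / 3 - \<epsilon>) * real (max_common_indep \<I>1 \<I>2)
            \<and> (\<forall>(i, Q) \<in> set qs. Q \<subseteq> V)
            \<and> real (length qs) \<le> 6 * (real (card V) / \<epsilon>))"
  proof (intro exI[of _ alg] allI impI)
    fix V :: "'a set" and \<I>1 \<I>2
    assume "matroid V \<I>1" "matroid V \<I>2"
    then interpret matroid_pair V \<I>1 \<I>2 by (simp add: matroid_pair_def)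
    let ?r = "real (max_common_indep \<I>1 \<I>2)"
    show "let orc = rank_oracles \<I>1 \<I>2; S = result orc (alg V); qs = queries orc (alg V)
           in S \<in> \<I>1 \<inter> \<I>2 \<and> real (card S) \<ge> (2 / 3 - \<epsilon>) * ?r
            \<and> (\<forall>(i, Q) \<in> set qs. Q \<subseteq> V) \<and> real (length qs) \<le> 6 * (real (card V) / \<epsilon>)"
    proof (cases "\<epsilon> \<ge> 2 / 3")
      case True
      then have "(2 / 3 - \<epsilon>) * ?r \<le> 0" by (simp add: mult_nonpos_nonneg)
      then show ?thesis
        using True eps M1.empty_indep M2.empty_indep unfolding alg_def by (simp add: Let_def)
    next
      case False
      then have alg: "alg = approx_matroid_intersection t" unfolding alg_def by simp
      note spec = approx_matroid_intersection_spec[of t]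
      let ?s = "real (card (result orc (approx_matroid_intersection t V)))"
      have "real (2 * t * max_common_indep \<I>1 \<I>2)
          \<le> real (3 * t * card (result orc (approx_matroid_intersection t V)) + max_common_indep \<I>1 \<I>2)"
        using spec(2) of_nat_le_iff by blast
      then have bound: "2 * real t * ?r \<le> 3 * real t * ?s + ?r" by simp
      have "1 \<le> 3 * \<epsilon> * real t" using t(1) eps by (simp add: field_simps)
      then have "?r \<le> 3 * \<epsilon> * real t * ?r" using mult_right_mono[of 1 _ ?r] by simp
      with bound have "(3 * real t) * ((2 / 3 - \<epsilon>) * ?r) \<le> (3 * real t) * ?s"
        by (simp add: algebra_simps)
      then have size: "(2 / 3 - \<epsilon>) * ?r \<le> ?s" using t_pos by simp
      have "real (length (queries orc (approx_matroid_intersection t V)))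
          \<le> real ((4 * t + 2) * card V)"
        using spec(4) of_nat_le_iff by blast
      also have "\<dots> = (4 * real t + 2) * real (card V)" by (simp add: algebra_simps)
      also have "\<dots> \<le> (6 / \<epsilon>) * real (card V)"
      proof (rule mult_right_mono)
        have "4 * real t + 2 \<le> 4 / 3 * (1 / \<epsilon>) + 6" using t(2) by simp
        \<comment> \<open>The constant \<open>6\<close> leaves \<open>14 / (3 * \<epsilon>)\<close>
          to absorb the additive \<open>6\<close>, which needs \<epsilon> at most
          \<open>7 / 9\<close>; here it is below \<open>2 / 3\<close>.\<close>
        also have "\<dots> \<le> 6 / \<epsilon>" using False eps by (simp add: field_simps)
        finally show "4 * real t + 2 \<le> 6 / \<epsilon>" .
      qed simp
      finally show ?thesis using spec(1,3) size unfolding alg legal_def by (simp add: Let_def)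
    qed
  qed
qed

end
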